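(* Let $k$ be a field, let $V$ be an arbitrary $k$-vector space (possibly infinite-dimensional), and let $f, g \in \operatorname{End}_k(V)$ be two nilpotent endomorphisms of the same order $n$. Then there exists $\tau \in \operatorname{Aut}_k(V)$ such that $g = \tau f \tau^{-1}$ if and only if $\mu_i(V,f) = \mu_i(V,g)$ (equality of cardinals) for all $1 \leq i \leq n$.
   Context: A nilpotent endomorphism $f$ of $V$ has order $n$ (a positive integer) if $f^n = 0$ and $f^{n-1} \neq 0$, where $f^0 = \mathrm{Id}_V$. For such $f$ and $1 \leq i \leq n$, $\mu_i(V,f)$ denotes the cardinal $$\mu_i(V,f) = \dim_k\Big( \operatorname{Ker} f^i \big/ \big[\operatorname{Ker} f^{i-1} + f(\operatorname{Ker} f^{i+1})\big]\Big),$$ the dimension being the cardinality of a basis. In particular $\mu_n(V,f) = \dim_k (V/\operatorname{Ker} f^{n-1})$ and $\mu_1(V,f) = \dim_k(\operatorname{Ker} f / f(\operatorname{Ker} f^2))$. *)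

theory Defs
  imports "Jordan_Normal_Form.VS_Connect"
begin

text \<open>
  The vector space \<open>V\<close> is a type carrying the locale \<^locale>\<open>vector_space\<close>. A quotient of
  subspaces of \<open>V\<close> is not a type, so it is given as a \<^typ>\<open>('k, 'v set) module\<close> record whose
  elements are cosets, over the field \<^term>\<open>class_ring :: 'k::field ring\<close>. This makes the notion of a
  basis for the locale \<^locale>\<open>vectorspace\<close> available for it.
\<close>

definition coset :: "'v::ab_group_add set \<Rightarrow> 'v \<Rightarrow> 'v set" where
  "coset W x = {x + w | w. w \<in> W}"

text \<open>
  The quotient space \<open>U / W\<close>, for subspaces \<open>W \<subseteq> U\<close>. A scalar multiple of a coset is saturated
  by \<open>W\<close> so that multiplication by \<open>0\<close> yields \<open>W\<close> and not \<open>{0}\<close>. The record fields \<open>mult\<close> and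
  \<open>one\<close> play no role in a module.
\<close>

definition quotient_space ::
  "('k::field \<Rightarrow> 'v::ab_group_add \<Rightarrow> 'v) \<Rightarrow> 'v set \<Rightarrow> 'v set \<Rightarrow> ('k, 'v set) module" where
  "quotient_space scale U W = \<lparr>
    carrier = coset W ` U,
    mult = undefined,
    one = undefined,
    zero = W,
    add = (\<lambda>A B. {a + b | a b. a \<in> A \<and> b \<in> B}),
    smult = (\<lambda>c A. {scale c a + w | a w. a \<in> A \<and> w \<in> W})\<rparr>"

text \<open>The dimension as a cardinal; the library's \<open>dim\<close> is a natural number. It is
  the cardinality of an arbitrary basis, bases of a vector space being equipotent.\<close>

definition cardinal_dim :: "('k, 'c) ring_scheme \<Rightarrow> ('k, 'b, 'd) module_scheme \<Rightarrow> 'b rel" where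
  "cardinal_dim K M = card_of (SOME B. vectorspace.basis K M B)"

definition ker_pow :: "('v::zero \<Rightarrow> 'v) \<Rightarrow> nat \<Rightarrow> 'v set" where
  "ker_pow f i = {v. (f ^^ i) v = 0}"

definition nilpotent_of_order :: "('v::zero \<Rightarrow> 'v) \<Rightarrow> nat \<Rightarrow> bool" where
  "nilpotent_of_order f n \<longleftrightarrow> 0 < n \<and> f ^^ n = (\<lambda>_. 0) \<and> f ^^ (n - 1) \<noteq> (\<lambda>_. 0)"

text \<open>Meaningful only for \<open>i \<ge> 1\<close>, because of the subtraction on natural numbers.\<close>

definition mu :: "('k::field \<Rightarrow> 'v::ab_group_add \<Rightarrow> 'v) \<Rightarrow> ('v \<Rightarrow> 'v) \<Rightarrow> nat \<Rightarrow> 'v set rel" where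
  "mu scale f i = cardinal_dim (class_ring :: 'k ring)
     (quotient_space scale (ker_pow f i)
       {x + y | x y. x \<in> ker_pow f (i - 1) \<and> y \<in> f ` ker_pow f (i + 1)})"

context vector_space
begin

lemma coset_eq_iff:
  assumes "subspace W"
  shows "coset W x = coset W y \<longleftrightarrow> x - y \<in> W"
proof
  assume eq: "coset W x = coset W y"
  have "x \<in> coset W x"
    using subspace_0[OF assms] unfolding coset_def by force
  then have "x \<in> coset W y" using eq by simp
  then show "x - y \<in> W" unfolding coset_def by auto
next
  assume d: "x - y \<in> W"
  have "\<exists>w'. x + w = y + w' \<and> w' \<in> W" if "w \<in> W" for w
    by (rule exI[of _ "(x - y) + w"]) (use subspace_add[OF assms d that] in auto)
  moreover have "\<exists>w'. y + w = x + w' \<and> w' \<in> W" if "w \<in> W" for w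
    by (rule exI[of _ "w - (x - y)"]) (use subspace_diff[OF assms that d] in auto)
  ultimately show "coset W x = coset W y" unfolding coset_def by auto
qed

lemma quotient_add:
  assumes "subspace W"
  shows "coset W x \<oplus>\<^bsub>quotient_space scale U W\<^esub> coset W y = coset W (x + y)"
proof -
  have "\<exists>w. (x + w1) + (y + w2) = x + y + w \<and> w \<in> W" if "w1 \<in> W" "w2 \<in> W" for w1 w2
    by (rule exI[of _ "w1 + w2"]) (use subspace_add[OF assms that] in \<open>auto simp: algebra_simps\<close>)
  moreover have "\<exists>a b. x + y + w = a + b \<and> (\<exists>w. a = x + w \<and> w \<in> W) \<and> (\<exists>w. b = y + w \<and> w \<in> W)"
    if "w \<in> W" for w
    by (rule exI[of _ "x + w"], rule exI[of _ y])
      (use that subspace_0[OF assms] in \<open>auto simp: algebra_simps\<close>)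
  ultimately show ?thesis unfolding quotient_space_def coset_def by fastforce
qed

lemma quotient_smult:
  assumes "subspace W"
  shows "c \<odot>\<^bsub>quotient_space scale U W\<^esub> coset W x = coset W (scale c x)"
proof -
  have "\<exists>w. scale c (x + w1) + w2 = scale c x + w \<and> w \<in> W" if "w1 \<in> W" "w2 \<in> W" for w1 w2
    by (rule exI[of _ "scale c w1 + w2"])
      (use subspace_add[OF assms subspace_scale[OF assms that(1)] that(2)]
        in \<open>auto simp: scale_right_distrib algebra_simps\<close>)
  moreover have "\<exists>a w'. scale c x + w = scale c a + w' \<and> (\<exists>w. a = x + w \<and> w \<in> W) \<and> w' \<in> W"
    if "w \<in> W" for w
    by (rule exI[of _ x], rule exI[of _ w]) (use that subspace_0[OF assms] in auto)
  ultimately show ?thesis unfolding quotient_space_def coset_def by fastforce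
qed

lemma vectorspace_quotient:
  assumes U: "subspace U" and W: "subspace W"
  shows "vectorspace (class_ring :: 'a ring) (quotient_space scale U W)"
proof -
  let ?Q = "quotient_space scale U W"
  have car: "carrier ?Q = coset W ` U" by (simp add: quotient_space_def)
  have zero: "\<zero>\<^bsub>?Q\<^esub> = coset W 0" by (simp add: quotient_space_def coset_def)
  note ops = quotient_add[OF W] quotient_smult[OF W]
  have "abelian_group ?Q"
  proof (rule abelian_groupI)
    fix X assume "X \<in> carrier ?Q"
    then obtain x where x: "x \<in> U" "X = coset W x" by (auto simp: car)
    then show "\<exists>Y\<in>carrier ?Q. Y \<oplus>\<^bsub>?Q\<^esub> X = \<zero>\<^bsub>?Q\<^esub>"
      by (intro bexI[of _ "coset W (- x)"]) (auto simp: ops zero car subspace_neg[OF U])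
  qed (auto simp: car zero ops ac_simps subspace_add[OF U] subspace_0[OF U])
  moreover have "Module.module (class_ring :: 'a ring) ?Q"
    by (rule moduleI[OF class_cring.is_cring \<open>abelian_group ?Q\<close>])
      (auto simp: car ops subspace_scale[OF U] scale_right_distrib scale_left_distrib)
  moreover have "Ring.field (class_ring :: 'a ring)"
    by (rule class_field.field_axioms)
  ultimately show ?thesis by (simp add: vectorspace_def)
qed

end

end

theory Submission
  imports Defs
begin

text \<open>
  Write \<open>K\<^sub>i = Ker f\<^sup>i\<close>. The map \<open>f\<close> induces an injection \<open>K\<^sub>m\<^sub>+\<^sub>2 / K\<^sub>m\<^sub>+\<^sub>1 \<rightarrow> K\<^sub>m\<^sub>+\<^sub>1 / K\<^sub>m\<close> with
  cokernel \<open>K\<^sub>m\<^sub>+\<^sub>1 / (K\<^sub>m + f(K\<^sub>m\<^sub>+\<^sub>2))\<close>, of dimension \<open>\<mu>\<^sub>m\<^sub>+\<^sub>1\<close>. So the image under \<open>f\<close> of a basis of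
  \<open>K\<^sub>m\<^sub>+\<^sub>2\<close> modulo \<open>K\<^sub>m\<^sub>+\<^sub>1\<close>, together with representatives of a basis of the cokernel, is a basis
  of \<open>K\<^sub>m\<^sub>+\<^sub>1\<close> modulo \<open>K\<^sub>m\<close>. Starting at \<open>m = n\<close> and descending to \<open>m = 0\<close>, this is done
  for \<open>f\<close> and \<open>g\<close> at once, the new representatives being matched by equality of the \<open>\<mu>\<^sub>i\<close>. The
  result is a relation \<open>R\<close> pairing a basis of \<open>V\<close> with another one; \<open>R\<close> is compatible with \<open>f\<close>
  and \<open>g\<close>, and extends linearly to \<open>\<tau>\<close>.
\<close>

text \<open>
  Bases of \<open>U / W\<close> are indexed families of vectors of \<open>U\<close>, so that a single relation
  \<open>R \<subseteq> V \<times> V\<close> carries two of them, \<open>fst\<close> and \<open>snd\<close>.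
\<close>

definition basis_mod ::
  "('k::field \<Rightarrow> 'v::ab_group_add \<Rightarrow> 'v) \<Rightarrow> 'v set \<Rightarrow> 'v set \<Rightarrow> ('i \<Rightarrow> 'v) \<Rightarrow> 'i set \<Rightarrow> bool" where
  "basis_mod scale W U p I \<longleftrightarrow>
    (\<forall>T c. finite T \<and> T \<subseteq> I \<and> (\<Sum>t\<in>T. scale (c t) (p t)) \<in> W \<longrightarrow> (\<forall>t\<in>T. c t = 0)) \<and>
    module.span scale (W \<union> p ` I) = U"

text \<open>The denominator in the definition of \<open>mu\<close>, in literally the same form, so
  that \<open>mu_basis_mod\<close> can fold it.\<close>

definition mu_subspace :: "('v::ab_group_add \<Rightarrow> 'v) \<Rightarrow> nat \<Rightarrow> 'v set" where
  "mu_subspace f i = {x + y | x y. x \<in> ker_pow f (i - 1) \<and> y \<in> f ` ker_pow f (i + 1)}"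

lemma mu_subspace_eq:
  "mu_subspace f i = (\<lambda>(x, y). x + f y) ` (ker_pow f (i - 1) \<times> ker_pow f (i + 1))"
  unfolding mu_subspace_def by auto

section \<open>Bases modulo a subspace\<close>

context vector_space
begin

interpretation self: vector_space_pair scale scale ..

lemma basis_modI:
  assumes "\<And>T c t. finite T \<Longrightarrow> T \<subseteq> I \<Longrightarrow> (\<Sum>t\<in>T. scale (c t) (p t)) \<in> W \<Longrightarrow> t \<in> T \<Longrightarrow> c t = 0"
    and "span (W \<union> p ` I) = U"
  shows "basis_mod scale W U p I"
  using assms unfolding basis_mod_def by blast

lemma basis_modD:
  assumes "basis_mod scale W U p I" "finite T" "T \<subseteq> I" "(\<Sum>t\<in>T. scale (c t) (p t)) \<in> W" "t \<in> T"
  shows "c t = 0"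
  using assms unfolding basis_mod_def by blast

lemma basis_mod_span: "basis_mod scale W U p I \<Longrightarrow> span (W \<union> p ` I) = U"
  by (simp add: basis_mod_def)

lemma basis_mod_subspace: "basis_mod scale W U p I \<Longrightarrow> subspace U"
  unfolding basis_mod_def using subspace_span by auto

lemma basis_mod_subset: "basis_mod scale W U p I \<Longrightarrow> W \<union> p ` I \<subseteq> U"
  using span_superset[of "W \<union> p ` I"] by (simp add: basis_mod_span)

lemma basis_mod_cong:
  assumes "\<And>i. i \<in> I \<Longrightarrow> p i = q i"
  shows "basis_mod scale W U p I \<longleftrightarrow> basis_mod scale W U q I"
proof -
  have "(\<Sum>t\<in>T. scale (c t) (p t)) = (\<Sum>t\<in>T. scale (c t) (q t))" if "T \<subseteq> I" for T c
    using that assms by (intro sum.cong) auto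
  moreover have "p ` I = q ` I" using assms by auto
  ultimately show ?thesis unfolding basis_mod_def by (metis (no_types, lifting))
qed

text \<open>Otherwise the coefficients 1 at \<open>s\<close> and -1 at \<open>t\<close> would give a
  nontrivial relation modulo \<open>W\<close>. Basis vectors thus stay distinct as cosets, which is
  more than injectivity of \<open>p\<close>.\<close>

lemma basis_mod_diff:
  assumes B: "basis_mod scale W U p I" and st: "s \<in> I" "t \<in> I" "p s - p t \<in> W"
  shows "s = t"
proof (rule ccontr)
  assume ne: "s \<noteq> t"
  then have "(\<Sum>i\<in>{s, t}. scale (if i = s then 1 else - 1) (p i)) \<in> W" using st by simp
  from basis_modD[OF B _ _ this, of s] st ne show False by simp
qed

lemma basis_mod_inj_on:
  assumes B: "basis_mod scale W U p I" and W: "subspace W"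
  shows "inj_on p I"
  using basis_mod_diff[OF B] subspace_0[OF W] by (auto intro!: inj_onI)

text \<open>Chiefly used with \<open>h\<close> mapping into pairs, where a family turns into
  \<open>fst\<close> or \<open>snd\<close> on a relation.\<close>

lemma basis_mod_reindex:
  assumes B: "basis_mod scale W U (p \<circ> h) I" and h: "inj_on h I"
  shows "basis_mod scale W U p (h ` I)"
proof (rule basis_modI)
  fix T c t assume T: "finite T" "T \<subseteq> h ` I" "(\<Sum>t\<in>T. scale (c t) (p t)) \<in> W" "t \<in> T"
  then obtain T' where T': "T' \<subseteq> I" "T = h ` T'" using subset_imageE by metis
  have inj: "inj_on h T'" using h T'(1) inj_on_subset by blast
  obtain t' where t': "t' \<in> T'" "t = h t'" using T T' by auto
  have "(\<Sum>t\<in>T'. scale (c (h t)) ((p \<circ> h) t)) \<in> W"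
    using T(3) unfolding T'(2) sum.reindex[OF inj] by simp
  from basis_modD[OF B _ T'(1) this t'(1)] show "c t = 0"
    using T(1) T'(2) inj t' finite_imageD by auto
qed (use basis_mod_span[OF B] in \<open>simp add: image_comp\<close>)

lemma basis_mod_empty: "subspace U \<Longrightarrow> basis_mod scale U U p {}"
  by (rule basis_modI) (auto simp: span_eq_iff)

text \<open>Reduction modulo \<open>U\<close> kills the coefficients outside \<open>I\<close>; what
  remains is a relation over \<open>I\<close> modulo \<open>W\<close>. This glues successive layers
  of the filtration by kernels.\<close>

lemma basis_mod_trans:
  assumes I: "basis_mod scale W U p I" and J: "basis_mod scale U X p J"
  shows "basis_mod scale W X p (I \<union> J)"
proof (rule basis_modI)
  fix T c t assume T: "finite T" "T \<subseteq> I \<union> J" "(\<Sum>t\<in>T. scale (c t) (p t)) \<in> W" "t \<in> T"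
  have U: "subspace U" by (rule basis_mod_subspace[OF I])
  let ?s = "\<lambda>A. \<Sum>t\<in>A. scale (c t) (p t)"
  have split: "?s T = ?s (T \<inter> I) + ?s (T - I)"
    using sum.Int_Diff[OF T(1)] by blast
  have "?s (T \<inter> I) \<in> U"
    using basis_mod_subset[OF I] by (auto intro!: subspace_sum[OF U] subspace_scale[OF U])
  moreover have "?s T \<in> U" using T(3) basis_mod_subset[OF I] by auto
  ultimately have "?s (T - I) \<in> U"
    using subspace_diff[OF U] split by (metis add_diff_cancel_left')
  then have 0: "c t = 0" if "t \<in> T - I" for t
    using basis_modD[OF J, of "T - I" c] T that by blast
  then have "?s (T - I) = 0" by (intro sum.neutral) auto
  then have "?s (T \<inter> I) \<in> W" using split T(3) by simp
  then have "c t = 0" if "t \<in> T \<inter> I" for t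
    using basis_modD[OF I, of "T \<inter> I" c] T that by blast
  with 0 T(4) show "c t = 0" by blast
next
  have "W \<union> p ` (I \<union> J) \<subseteq> X"
    using basis_mod_subset[OF I] basis_mod_subset[OF J] by auto
  then have 1: "span (W \<union> p ` (I \<union> J)) \<subseteq> X"
    using basis_mod_subspace[OF J] span_minimal by blast
  have "U \<subseteq> span (W \<union> p ` (I \<union> J))"
    unfolding basis_mod_span[OF I, symmetric] by (rule span_mono) auto
  then have "span (U \<union> p ` J) \<subseteq> span (W \<union> p ` (I \<union> J))"
    by (intro span_minimal) (auto intro: span_base)
  with 1 show "span (W \<union> p ` (I \<union> J)) = X" using basis_mod_span[OF J] by blast
qed

text \<open>For subspaces \<open>W\<close> and \<open>W'\<close>, the last three assumptions say
  that the map \<open>U / W\<close> to \<open>U' / W'\<close> induced by \<open>f\<close> is well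
  defined, injective and surjective. It is applied to a projection, to the shift between kernel
  layers and to a conjugating map.\<close>

lemma basis_mod_image:
  assumes f: "Vector_Spaces.linear scale scale f"
    and B: "basis_mod scale W U p I"
    and fW: "f ` W \<subseteq> W'"
    and inj: "\<And>u. u \<in> U \<Longrightarrow> f u \<in> W' \<Longrightarrow> u \<in> W"
    and U': "span (W' \<union> f ` U) = U'"
  shows "basis_mod scale W' U' (f \<circ> p) I"
proof (rule basis_modI)
  fix T c t assume T: "finite T" "T \<subseteq> I" "(\<Sum>t\<in>T. scale (c t) ((f \<circ> p) t)) \<in> W'" "t \<in> T"
  let ?s = "\<Sum>t\<in>T. scale (c t) (p t)"
  have "f ?s \<in> W'" using T(3) by (simp add: self.linear_sum[OF f] self.linear_scale[OF f])
  moreover have "?s \<in> U"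
    using basis_mod_subset[OF B] T(2)
    by (auto intro!: subspace_sum subspace_scale basis_mod_subspace[OF B])
  ultimately have "?s \<in> W" using inj by blast
  from basis_modD[OF B T(1,2) this T(4)] show "c t = 0" .
next
  let ?S = "span (W' \<union> (f \<circ> p) ` I)"
  have "f ` U = span (f ` (W \<union> p ` I))"
    using self.linear_span_image[OF f] basis_mod_span[OF B] by metis
  also have "\<dots> \<subseteq> ?S" using fW by (intro span_mono) auto
  finally have "span (W' \<union> f ` U) \<subseteq> ?S"
    by (intro span_minimal) (auto intro: span_base)
  moreover have "?S \<subseteq> span (W' \<union> f ` U)"
    using basis_mod_subset[OF B] by (intro span_mono) auto
  ultimately show "?S = U'" using U' by blast
qed

text \<open>The bridge to \<open>independent\<close> and \<open>span\<close>, for which extension of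
  linear maps and equipotence of bases are available.\<close>

lemma basis_mod_0:
  assumes B: "basis_mod scale {0} U p I"
  shows "inj_on p I" "independent (p ` I)" "span (p ` I) = U"
proof -
  show inj: "inj_on p I" by (rule basis_mod_inj_on[OF B]) simp
  show "span (p ` I) = U"
    using basis_mod_span[OF B] by simp
  have B': "basis_mod scale {0} U id (p ` I)"
    by (rule basis_mod_reindex) (use B inj in simp_all)
  show "independent (p ` I)"
    unfolding independent_explicit_finite_subsets
    using basis_modD[OF B'] by auto
qed

section \<open>Cardinality and existence of bases modulo a subspace\<close>

text \<open>A projection along \<open>W\<close> onto a complement stands in for the quotient map
  without leaving the type of \<open>V\<close>.\<close>

lemma exists_linear_with_kernel:
  assumes W: "subspace W"
  obtains \<pi> where "Vector_Spaces.linear scale scale \<pi>" "\<And>x. \<pi> x = 0 \<longleftrightarrow> x \<in> W"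
proof -
  obtain C where C: "C \<subseteq> W" "independent C" "W \<subseteq> span C" by (rule maximal_independent_subset)
  let ?D = "extend_basis C"
  have D: "independent ?D" "span ?D = UNIV"
    using C(2) by (simp_all add: independent_extend_basis)
  obtain \<pi> where \<pi>: "Vector_Spaces.linear scale scale \<pi>" "\<forall>d\<in>?D. \<pi> d = (if d \<in> C then 0 else d)"
    using self.linear_independent_extend[OF D(1), of "\<lambda>d. if d \<in> C then 0 else d"] by blast
  have 0: "\<pi> x = 0" if "x \<in> W" for x
    by (rule self.linear_eq_0_on_span[OF \<pi>(1), of C])
      (use that C(3) \<pi>(2) extend_basis_superset[OF C(2)] in auto)
  \<comment> \<open>The condition \<open>x - \<pi> x \<in> W\<close> is linear in \<open>x\<close>.
    It holds on \<open>?D\<close>, hence everywhere, and so forces the kernel of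
    \<open>\<pi>\<close> into \<open>W\<close>.\<close>
  have sub: "subspace {x. x - \<pi> x \<in> W}"
    unfolding subspace_def
    using subspace_0[OF W] subspace_add[OF W] subspace_scale[OF W]
    by (auto simp: self.linear_0[OF \<pi>(1)] self.linear_add[OF \<pi>(1)] self.linear_scale[OF \<pi>(1)]
        add_diff_add scale_right_diff_distrib[symmetric])
  have "?D \<subseteq> {x. x - \<pi> x \<in> W}" using \<pi>(2) C(1) subspace_0[OF W] by auto
  then have "x - \<pi> x \<in> W" for x
    using span_minimal[OF _ sub, of ?D] D(2) by blast
  then have "x \<in> W" if "\<pi> x = 0" for x using that by (metis diff_zero)
  with 0 \<pi>(1) that show ?thesis by blast
qed

lemma basis_mod_kernel:
  assumes \<pi>: "Vector_Spaces.linear scale scale \<pi>" "\<And>x. \<pi> x = 0 \<longleftrightarrow> x \<in> W"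
    and B: "basis_mod scale W U p I"
  shows "basis_mod scale {0} (\<pi> ` U) (\<pi> \<circ> p) I"
proof (rule basis_mod_image[OF \<pi>(1) B])
  show "span ({0} \<union> \<pi> ` U) = \<pi> ` U"
    using self.linear_subspace_image[OF \<pi>(1)] basis_mod_subspace[OF B] by simp
qed (use \<pi>(2) in auto)

text \<open>Projecting along \<open>W\<close> turns both families into ordinary bases of the image
  of \<open>U\<close>.\<close>

lemma basis_mod_card_eq:
  assumes W: "subspace W" and I: "basis_mod scale W U p I" and J: "basis_mod scale W U q J"
  shows "(card_of I, card_of J) \<in> ordIso"
proof -
  obtain \<pi> where \<pi>: "Vector_Spaces.linear scale scale \<pi>" "\<And>x. \<pi> x = 0 \<longleftrightarrow> x \<in> W"
    using exists_linear_with_kernel[OF W] by blast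
  note * = basis_mod_kernel[OF \<pi> I] basis_mod_kernel[OF \<pi> J]
  obtain h where "bij_betw h ((\<pi> \<circ> p) ` I) ((\<pi> \<circ> q) ` J)"
    using bij_if_span_eq_span_bases[OF basis_mod_0(2)[OF *(1)] basis_mod_0(2)[OF *(2)]]
      basis_mod_0(3)[OF *(1)] basis_mod_0(3)[OF *(2)] by auto
  then have "(card_of ((\<pi> \<circ> p) ` I), card_of ((\<pi> \<circ> q) ` J)) \<in> ordIso"
    by (rule card_of_ordIsoI)
  moreover have "(card_of I, card_of ((\<pi> \<circ> p) ` I)) \<in> ordIso"
    "(card_of J, card_of ((\<pi> \<circ> q) ` J)) \<in> ordIso"
    using card_of_ordIsoI[OF inj_on_imp_bij_betw[OF basis_mod_0(1)[OF *(1)]]]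
      card_of_ordIsoI[OF inj_on_imp_bij_betw[OF basis_mod_0(1)[OF *(2)]]] .
  ultimately show ?thesis by (metis ordIso_transitive ordIso_symmetric)
qed

text \<open>A basis \<open>C\<close> of \<open>W\<close> extends to a basis \<open>D\<close> of
  \<open>U\<close>, and \<open>D - C\<close> spans a complement of \<open>W\<close> in
  \<open>U\<close>.\<close>

lemma exists_basis_mod:
  assumes W: "subspace W" and U: "subspace U" and "W \<subseteq> U"
  obtains B :: "'b set" and r where "basis_mod scale W U r B"
proof -
  obtain C where C: "C \<subseteq> W" "independent C" "W \<subseteq> span C" by (rule maximal_independent_subset)
  obtain D where D: "C \<subseteq> D" "D \<subseteq> U" "independent D" "U \<subseteq> span D"
    using maximal_independent_subset_extend[of C U] C(1,2) \<open>W \<subseteq> U\<close> by blast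
  have spanC: "span C = W" using C W by (simp add: span_subspace)
  have "basis_mod scale W U id (D - C)"
  proof (rule basis_modI)
    fix T c t assume T: "finite T" "T \<subseteq> D - C" "(\<Sum>t\<in>T. scale (c t) (id t)) \<in> W" "t \<in> T"
    then obtain S d where S: "finite S" "S \<subseteq> C" "(\<Sum>t\<in>T. scale (c t) t) = (\<Sum>s\<in>S. scale (d s) s)"
      unfolding spanC[symmetric] span_explicit by auto
    \<comment> \<open>The combination over \<open>T\<close> equals one over \<open>S\<close>, a
      subset of \<open>C\<close>; \<open>?e\<close> collects their difference into a single relation
      among vectors of \<open>D\<close>.\<close>
    let ?e = "\<lambda>x. if x \<in> S then - d x else c x"
    have dis: "S \<inter> T = {}" using S T by auto
    have "(\<Sum>x\<in>S \<union> T. scale (?e x) x) = (\<Sum>s\<in>S. scale (?e s) s) + (\<Sum>t\<in>T. scale (?e t) t)"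
      using dis S T by (intro sum.union_disjoint) auto
    also have "(\<Sum>t\<in>T. scale (?e t) t) = (\<Sum>t\<in>T. scale (c t) t)"
      using dis by (intro sum.cong) auto
    also have "(\<Sum>s\<in>S. scale (?e s) s) = - (\<Sum>s\<in>S. scale (d s) s)"
      unfolding sum_negf[symmetric] by (intro sum.cong) auto
    finally have "(\<Sum>x\<in>S \<union> T. scale (?e x) x) = 0" using S(3) by simp
    then have "?e t = 0"
      using independentD[OF D(3), of "S \<union> T" ?e t] S T D(1) by blast
    then show "c t = 0" using dis T(4) by (auto split: if_splits)
  next
    show "span (W \<union> id ` (D - C)) = U"
    proof (rule span_subspace[OF _ _ U])
      show "W \<union> id ` (D - C) \<subseteq> U" using D \<open>W \<subseteq> U\<close> by auto
      have "span D \<subseteq> span (W \<union> id ` (D - C))" using C(1) by (intro span_mono) auto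
      then show "U \<subseteq> span (W \<union> id ` (D - C))" using D(4) by blast
    qed
  qed
  then show ?thesis using that by blast
qed

section \<open>Comparison with bases of the quotient module\<close>

text \<open>The right-hand side amounts to an equality of cosets, the form that membership in a span
  of the quotient module takes.\<close>

lemma span_Un_image_iff:
  assumes W: "subspace W"
  shows "x \<in> span (W \<union> p ` I) \<longleftrightarrow>
    (\<exists>T c. finite T \<and> T \<subseteq> I \<and> x - (\<Sum>t\<in>T. scale (c t) (p t)) \<in> W)"
proof
  assume "x \<in> span (W \<union> p ` I)"
  then obtain w y where wy: "x = w + y" "w \<in> W" "y \<in> span (p ` I)"
    unfolding span_Un span_eq_iff[THEN iffD2, OF W] by blast
  then obtain S d where S: "finite S" "S \<subseteq> p ` I" "y = (\<Sum>s\<in>S. scale (d s) s)"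
    unfolding span_explicit by auto
  \<comment> \<open>As \<open>p\<close> may repeat vectors, \<open>T\<close> picks one index for
    each vector of \<open>S\<close>.\<close>
  from S(2) obtain T where T: "T \<subseteq> I" "inj_on p T" "S = p ` T"
    unfolding subset_image_inj by blast
  have "y = (\<Sum>t\<in>T. scale (d (p t)) (p t))"
    using S(3) T(3) sum.reindex[OF T(2)] by simp
  then show "\<exists>T c. finite T \<and> T \<subseteq> I \<and> x - (\<Sum>t\<in>T. scale (c t) (p t)) \<in> W"
    using wy S(1) T finite_imageD by (intro exI[of _ T] exI[of _ "\<lambda>t. d (p t)"]) auto
next
  assume "\<exists>T c. finite T \<and> T \<subseteq> I \<and> x - (\<Sum>t\<in>T. scale (c t) (p t)) \<in> W"
  then obtain T c where T: "T \<subseteq> I" "x - (\<Sum>t\<in>T. scale (c t) (p t)) \<in> W" by blast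
  have "(\<Sum>t\<in>T. scale (c t) (p t)) \<in> span (W \<union> p ` I)"
    using T(1) by (intro span_sum span_scale span_base) auto
  moreover have "x - (\<Sum>t\<in>T. scale (c t) (p t)) \<in> span (W \<union> p ` I)"
    using T(2) by (intro span_base) auto
  ultimately show "x \<in> span (W \<union> p ` I)" using span_add by fastforce
qed

lemma quotient_lincomb:
  assumes U: "subspace U" and W: "subspace W"
    and "finite A" "\<And>X. X \<in> A \<Longrightarrow> r X \<in> U \<and> coset W (r X) = X"
  shows "module.lincomb (quotient_space scale U W) a A = coset W (\<Sum>X\<in>A. scale (a X) (r X))"
proof -
  let ?Q = "quotient_space scale U W"
  interpret Q: vectorspace "class_ring :: 'a ring" ?Q by (rule vectorspace_quotient[OF U W])
  have car: "carrier ?Q = coset W ` U" by (simp add: quotient_space_def)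
  have zero: "\<zero>\<^bsub>?Q\<^esub> = coset W 0" by (simp add: quotient_space_def coset_def)
  show ?thesis using assms(3,4)
  proof (induction A rule: finite_induct)
    case empty
    then show ?case by (simp add: Q.lincomb_def zero)
  next
    case (insert X A)
    have "A \<subseteq> carrier ?Q" "X \<in> carrier ?Q" using insert.prems car by (metis imageI insertCI subsetI)+
    then have "Q.lincomb a (A \<union> {X}) = (a X \<odot>\<^bsub>?Q\<^esub> X) \<oplus>\<^bsub>?Q\<^esub> Q.lincomb a A"
      using insert.hyps by (intro Q.lincomb_insert) auto
    also have "\<dots> = (a X \<odot>\<^bsub>?Q\<^esub> coset W (r X)) \<oplus>\<^bsub>?Q\<^esub> coset W (\<Sum>X\<in>A. scale (a X) (r X))"
      using insert by simp
    finally show ?case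
      using insert.hyps by (simp add: quotient_smult[OF W] quotient_add[OF W])
  qed
qed

text \<open>A set of cosets serves as its own index set, with \<open>r\<close> choosing
  representatives. A combination of cosets is zero exactly when that of the representatives lies in
  \<open>W\<close>.\<close>

lemma quotient_basis_iff:
  assumes U: "subspace U" and W: "subspace W" and WU: "W \<subseteq> U"
    and r: "\<And>X. X \<in> B \<Longrightarrow> r X \<in> U \<and> coset W (r X) = X"
  shows "vectorspace.basis (class_ring :: 'a ring) (quotient_space scale U W) B \<longleftrightarrow> basis_mod scale W U r B"
proof -
  let ?Q = "quotient_space scale U W"
  interpret Q: vectorspace "class_ring :: 'a ring" ?Q by (rule vectorspace_quotient[OF U W])
  have car: "carrier ?Q = coset W ` U" by (simp add: quotient_space_def)
  have zero: "\<zero>\<^bsub>?Q\<^esub> = coset W 0" by (simp add: quotient_space_def coset_def)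
  have BC: "B \<subseteq> carrier ?Q" using r car by (metis imageI subsetI)
  have lc: "Q.lincomb a T = coset W (\<Sum>X\<in>T. scale (a X) (r X))" if "finite T" "T \<subseteq> B" for a T
    using that r by (intro quotient_lincomb[OF U W]) auto
  have "Q.lin_indpt B \<longleftrightarrow>
    (\<forall>T c. finite T \<and> T \<subseteq> B \<and> (\<Sum>t\<in>T. scale (c t) (r t)) \<in> W \<longrightarrow> (\<forall>t\<in>T. c t = 0))"
    unfolding Q.lin_dep_def zero using lc by (auto simp: coset_eq_iff[OF W])
  moreover have "Q.gen_set B \<longleftrightarrow> span (W \<union> r ` B) = U"
  proof -
    have mem: "coset W u \<in> Q.span B \<longleftrightarrow> u \<in> span (W \<union> r ` B)" for u
    proof -
      have "coset W u \<in> Q.span B \<longleftrightarrow>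
        (\<exists>T c. finite T \<and> T \<subseteq> B \<and> coset W u = coset W (\<Sum>t\<in>T. scale (c t) (r t)))"
      proof
        assume "\<exists>T c. finite T \<and> T \<subseteq> B \<and> coset W u = coset W (\<Sum>t\<in>T. scale (c t) (r t))"
        then obtain T c where "finite T" "T \<subseteq> B" "coset W u = Q.lincomb c T" by (auto simp: lc)
        then show "coset W u \<in> Q.span B" unfolding Q.span_def by auto
      next
        assume "coset W u \<in> Q.span B"
        then obtain T c where T: "finite T" "T \<subseteq> B" "coset W u = Q.lincomb c T"
          unfolding Q.span_def by auto
        then have "coset W u = coset W (\<Sum>t\<in>T. scale (c t) (r t))" using lc[of T c] by simp
        then show "\<exists>T c. finite T \<and> T \<subseteq> B \<and> coset W u = coset W (\<Sum>t\<in>T. scale (c t) (r t))"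
          using T(1,2) by blast
      qed
      then show ?thesis unfolding span_Un_image_iff[OF W] coset_eq_iff[OF W] .
    qed
    have "Q.span B \<subseteq> coset W ` U"
      using Q.span_is_subset2[OF BC] car by simp
    moreover have "span (W \<union> r ` B) \<subseteq> U"
      using WU r by (intro span_minimal[OF _ U]) auto
    moreover have "coset W ` U \<subseteq> Q.span B \<longleftrightarrow> U \<subseteq> span (W \<union> r ` B)"
      unfolding image_subset_iff mem by blast
    ultimately show ?thesis unfolding car by (metis subset_antisym order_refl)
  qed
  ultimately show ?thesis unfolding Q.basis_def basis_mod_def using BC by blast
qed

text \<open>The choice in \<open>cardinal_dim\<close> yields a basis only once some basis is known
  to exist; the cosets of a basis modulo \<open>W\<close> provide one.\<close>

lemma cardinal_dim_quotient:
  assumes U: "subspace U" and W: "subspace W" and WU: "W \<subseteq> U"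
  obtains B :: "'b set set" and r where
    "cardinal_dim (class_ring :: 'a ring) (quotient_space scale U W) = card_of B" "basis_mod scale W U r B"
proof -
  let ?Q = "quotient_space scale U W"
  interpret Q: vectorspace "class_ring :: 'a ring" ?Q by (rule vectorspace_quotient[OF U W])
  obtain B0 :: "'b set" and p where p: "basis_mod scale W U p B0" using exists_basis_mod[OF W U WU] by blast
  let ?h = "\<lambda>b. coset W (p b)"
  \<comment> \<open>Recovers a basis vector from its coset, which is possible because
    \<open>?h\<close> is injective on \<open>B0\<close>.\<close>
  define r where "r X = p (inv_into B0 ?h X)" for X
  have inj: "inj_on ?h B0"
    using basis_mod_diff[OF p] by (auto intro!: inj_onI simp: coset_eq_iff[OF W])
  have rh: "r (?h b) = p b" if "b \<in> B0" for b
    unfolding r_def using inv_into_f_f[OF inj that] by simp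
  have "basis_mod scale W U (r \<circ> ?h) B0" using p basis_mod_cong[of B0 "r \<circ> ?h" p] rh by simp
  then have "basis_mod scale W U r (?h ` B0)" using basis_mod_reindex[OF _ inj] by blast
  moreover have "r X \<in> U \<and> coset W (r X) = X" if "X \<in> ?h ` B0" for X
    using that rh basis_mod_subset[OF p] by auto
  ultimately have "Q.basis (?h ` B0)" using quotient_basis_iff[OF U W WU] by blast
  then have B: "Q.basis (SOME B. Q.basis B)" (is "Q.basis ?B") by (rule someI)
  \<comment> \<open>The chosen basis may differ from the exhibited one, so representatives are
    picked anew.\<close>
  then have "?B \<subseteq> coset W ` U" unfolding Q.basis_def by (simp add: quotient_space_def)
  then have "\<forall>X\<in>?B. \<exists>u. u \<in> U \<and> coset W u = X" by blast
  from bchoice[OF this] obtain q where "\<And>X. X \<in> ?B \<Longrightarrow> q X \<in> U \<and> coset W (q X) = X" by blast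
  then have "basis_mod scale W U q ?B" using quotient_basis_iff[OF U W WU] B by blast
  then show ?thesis using that unfolding cardinal_dim_def by blast
qed

section \<open>Kernels of powers and the quotients behind \<open>mu\<close>\<close>

lemma linear_funpow:
  "Vector_Spaces.linear scale scale f \<Longrightarrow> Vector_Spaces.linear scale scale (f ^^ i)"
proof (induction i)
  case 0
  show ?case using linear_id by (simp add: id_def)
next
  case (Suc i)
  then show ?case
    using Vector_Spaces.linear_compose[of scale scale "f ^^ i" scale f] by (simp only: funpow.simps)
qed

lemma subspace_ker_pow:
  "Vector_Spaces.linear scale scale f \<Longrightarrow> subspace (ker_pow f i)"
  unfolding ker_pow_def by (rule self.linear_subspace_kernel[OF linear_funpow])

lemma ker_pow_Suc_iff: "f x \<in> ker_pow f i \<longleftrightarrow> x \<in> ker_pow f (Suc i)"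
  by (simp add: ker_pow_def funpow_swap1)

lemma ker_pow_mono:
  assumes f: "Vector_Spaces.linear scale scale f" and "i \<le> j"
  shows "ker_pow f i \<subseteq> ker_pow f j"
proof -
  have "ker_pow f i \<subseteq> ker_pow f (Suc i)" for i
    by (auto simp: ker_pow_def self.linear_0[OF f])
  then show ?thesis by (rule lift_Suc_mono_le[OF _ \<open>i \<le> j\<close>])
qed

lemma subspace_mu_subspace:
  assumes f: "Vector_Spaces.linear scale scale f"
  shows "subspace (mu_subspace f i)"
  unfolding mu_subspace_def
  by (rule subspace_sums[OF subspace_ker_pow[OF f]
      self.linear_subspace_image[OF f subspace_ker_pow[OF f]]])

lemma mu_subspace_subset:
  assumes f: "Vector_Spaces.linear scale scale f" and "1 \<le> i"
  shows "mu_subspace f i \<subseteq> ker_pow f i"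
proof
  fix z assume "z \<in> mu_subspace f i"
  then obtain x y where z: "z = x + y" "x \<in> ker_pow f (i - 1)" "y \<in> f ` ker_pow f (i + 1)"
    unfolding mu_subspace_def by blast
  have "x \<in> ker_pow f i" using z(2) ker_pow_mono[OF f, of "i - 1" i] by auto
  moreover have "y \<in> ker_pow f i" using z(3) by (auto simp: ker_pow_Suc_iff)
  ultimately show "z \<in> ker_pow f i" unfolding z(1) by (rule subspace_add[OF subspace_ker_pow[OF f]])
qed

lemma mu_basis_mod:
  assumes f: "Vector_Spaces.linear scale scale f" and "1 \<le> i"
  obtains B :: "'b set set" and r where
    "mu scale f i = card_of B" "basis_mod scale (mu_subspace f i) (ker_pow f i) r B"
proof -
  obtain B :: "'b set set" and r where
    B: "cardinal_dim (class_ring :: 'a ring) (quotient_space scale (ker_pow f i) (mu_subspace f i))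
      = card_of B"
      "basis_mod scale (mu_subspace f i) (ker_pow f i) r B"
    by (rule cardinal_dim_quotient[OF subspace_ker_pow[OF f] subspace_mu_subspace[OF f]
        mu_subspace_subset[OF f \<open>1 \<le> i\<close>]])
  show ?thesis
    by (rule that[OF _ B(2)]) (unfold mu_def mu_subspace_def[symmetric], rule B(1))
qed

text \<open>The induced map is injective because \<open>f u\<close> lies in Ker f^m exactly when
  \<open>u\<close> lies in Ker f^(m+1). Its image is Ker f^m + f(Ker f^(m+2)) modulo Ker f^m, hence
  the index \<open>Suc m\<close> of \<open>mu_subspace\<close>.\<close>

lemma basis_mod_ker_pow_shift:
  assumes f: "Vector_Spaces.linear scale scale f"
    and B: "basis_mod scale (ker_pow f (Suc m)) (ker_pow f (Suc (Suc m))) p I"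
  shows "basis_mod scale (ker_pow f m) (mu_subspace f (Suc m)) (f \<circ> p) I"
proof (rule basis_mod_image[OF f B])
  show "span (ker_pow f m \<union> f ` ker_pow f (Suc (Suc m))) = mu_subspace f (Suc m)"
    unfolding span_Un mu_subspace_def span_eq_iff[THEN iffD2, OF subspace_ker_pow[OF f]]
      span_eq_iff[THEN iffD2, OF self.linear_subspace_image[OF f subspace_ker_pow[OF f]]]
    by simp
qed (auto simp: ker_pow_Suc_iff)

section \<open>Invariance under conjugation\<close>

text \<open>Since \<open>\<tau>\<close> carries numerator and denominator for \<open>f\<close> onto
  those for \<open>g\<close>, it transports a basis of one quotient to the other, where any two
  bases are equipotent.\<close>

lemma mu_conjugate:
  assumes f: "Vector_Spaces.linear scale scale f" and g: "Vector_Spaces.linear scale scale g"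
    and \<tau>: "Vector_Spaces.linear scale scale \<tau>" "bij \<tau>" and comm: "\<And>x. \<tau> (f x) = g (\<tau> x)"
    and i: "1 \<le> i"
  shows "(mu scale f i, mu scale g i) \<in> ordIso"
proof -
  have pow: "\<tau> ((f ^^ j) x) = (g ^^ j) (\<tau> x)" for j x
    by (induction j) (simp_all add: comm)
  have \<tau>0: "\<tau> x = 0 \<longleftrightarrow> x = 0" for x
    using self.linear_inj_iff_eq_0[OF \<tau>(1)] bij_is_inj[OF \<tau>(2)] self.linear_0[OF \<tau>(1)] by auto
  have ker: "\<tau> ` ker_pow f j = ker_pow g j" for j
  proof (intro equalityI subsetI)
    fix y assume y: "y \<in> ker_pow g j"
    obtain x where "y = \<tau> x" using bij_is_surj[OF \<tau>(2)] by (rule surjE)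
    then show "y \<in> \<tau> ` ker_pow f j" using y by (auto simp: ker_pow_def pow[symmetric] \<tau>0)
  qed (auto simp: ker_pow_def pow[symmetric] \<tau>0)
  have sub: "\<tau> ` mu_subspace f i = mu_subspace g i"
  proof -
    \<comment> \<open>Applying \<open>\<tau>\<close> to \<open>x + f y\<close> amounts to applying
      it to \<open>x\<close> and \<open>y\<close> separately, so \<open>ker\<close> can be used on
      each factor of the product.\<close>
    have "\<tau> ` mu_subspace f i =
      (\<lambda>(x, y). x + g y) ` map_prod \<tau> \<tau> ` (ker_pow f (i - 1) \<times> ker_pow f (i + 1))"
      unfolding mu_subspace_eq image_image
      by (intro image_cong) (auto simp: self.linear_add[OF \<tau>(1)] comm)
    then show ?thesis by (simp only: map_prod_surj_on[OF ker ker] mu_subspace_eq)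
  qed
  obtain B :: "'b set set" and r where
    B: "mu scale f i = card_of B" "basis_mod scale (mu_subspace f i) (ker_pow f i) r B"
    using mu_basis_mod[OF f i] .
  obtain C :: "'b set set" and s where
    C: "mu scale g i = card_of C" "basis_mod scale (mu_subspace g i) (ker_pow g i) s C"
    using mu_basis_mod[OF g i] .
  have "basis_mod scale (mu_subspace g i) (ker_pow g i) (\<tau> \<circ> r) B"
  proof (rule basis_mod_image[OF \<tau>(1) B(2)])
    show "span (mu_subspace g i \<union> \<tau> ` ker_pow f i) = ker_pow g i"
      unfolding ker using mu_subspace_subset[OF g i] subspace_ker_pow[OF g]
      by (simp add: Un_absorb1)
    show "u \<in> mu_subspace f i" if "\<tau> u \<in> mu_subspace g i" for u
      using that inj_image_mem_iff[OF bij_is_inj[OF \<tau>(2)], of u "mu_subspace f i"] by (simp add: sub)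
  qed (use sub in auto)
  then show ?thesis
    unfolding B(1) C(1) by (rule basis_mod_card_eq[OF subspace_mu_subspace[OF g] _ C(2)])
qed

section \<open>Matched bases along the kernel filtration\<close>

text \<open>Equal cardinals give a bijection \<open>h\<close> of index sets, and \<open>S\<close>
  consists of the pairs of representatives matched by it.\<close>

lemma mu_basis_relation:
  assumes f: "Vector_Spaces.linear scale scale f" and g: "Vector_Spaces.linear scale scale g"
    and i: "1 \<le> i" and eq: "(mu scale f i, mu scale g i) \<in> ordIso"
  obtains S where "basis_mod scale (mu_subspace f i) (ker_pow f i) fst S"
    "basis_mod scale (mu_subspace g i) (ker_pow g i) snd S"
proof -
  obtain B :: "'b set set" and r where
    B: "mu scale f i = card_of B" "basis_mod scale (mu_subspace f i) (ker_pow f i) r B"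
    using mu_basis_mod[OF f i] .
  obtain C :: "'b set set" and s where
    C: "mu scale g i = card_of C" "basis_mod scale (mu_subspace g i) (ker_pow g i) s C"
    using mu_basis_mod[OF g i] .
  obtain h where h: "bij_betw h B C"
    using eq unfolding B(1) C(1) card_of_ordIso[symmetric] by blast
  let ?k = "\<lambda>X. (r X, s (h X))"
  have inj: "inj_on ?k B"
    using basis_mod_inj_on[OF B(2) subspace_mu_subspace[OF f]] by (auto simp: inj_on_def)
  have "basis_mod scale (mu_subspace f i) (ker_pow f i) fst (?k ` B)"
    by (rule basis_mod_reindex[OF _ inj]) (use B(2) in \<open>simp add: comp_def\<close>)
  moreover have "basis_mod scale (mu_subspace g i) (ker_pow g i) snd (?k ` B)"
  proof (rule basis_mod_reindex[OF _ inj])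
    \<comment> \<open>The second family is indexed by \<open>C\<close>; the inverse of
      \<open>h\<close> brings it back to \<open>B\<close>, over which the pairs are formed.\<close>
    have hinv: "inj_on (inv_into B h) C" "inv_into B h ` C = B"
      using bij_betw_inv_into[OF h] by (auto simp: bij_betw_def)
    have "basis_mod scale (mu_subspace g i) (ker_pow g i) ((s \<circ> h) \<circ> inv_into B h) C"
      using C(2) basis_mod_cong[of C "(s \<circ> h) \<circ> inv_into B h" s] bij_betw_inv_into_right[OF h]
      by simp
    from basis_mod_reindex[OF this hinv(1)]
    show "basis_mod scale (mu_subspace g i) (ker_pow g i) (snd \<circ> ?k) B"
      by (simp add: hinv(2) comp_def)
  qed
  ultimately show ?thesis by (rule that)
qed

text \<open>\<open>R\<close> pairs the bases of \<open>V\<close> modulo \<open>K\<^sub>m\<close> found so far; \<open>L\<close> is its last layer, whose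
  images under \<open>f\<close> and \<open>g\<close> are still missing from \<open>R\<close>.\<close>
lemma exists_jordan_basis_relation:
  assumes f: "Vector_Spaces.linear scale scale f" and g: "Vector_Spaces.linear scale scale g"
    and fn: "ker_pow f n = UNIV" and gn: "ker_pow g n = UNIV"
    and eq: "\<And>i. i \<in> {1..n} \<Longrightarrow> (mu scale f i, mu scale g i) \<in> ordIso"
    and "m \<le> n"
  shows "\<exists>R L. L \<subseteq> R
    \<and> basis_mod scale (ker_pow f m) UNIV fst R \<and> basis_mod scale (ker_pow g m) UNIV snd R
    \<and> basis_mod scale (ker_pow f m) (ker_pow f (Suc m)) fst L
    \<and> basis_mod scale (ker_pow g m) (ker_pow g (Suc m)) snd L
    \<and> map_prod f g ` (R - L) \<subseteq> R"
  using \<open>m \<le> n\<close>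
proof (induction m rule: inc_induct)
  case base
  \<comment> \<open>The filtration is constant from \<open>n\<close> on, so the empty relation
    serves as both \<open>R\<close> and \<open>L\<close>.\<close>
  have "ker_pow f (Suc n) = UNIV" "ker_pow g (Suc n) = UNIV"
    using ker_pow_mono[OF f, of n "Suc n"] ker_pow_mono[OF g, of n "Suc n"] fn gn by auto
  then show ?case
    using basis_mod_empty[OF subspace_UNIV] fn gn by (intro exI[of _ "{}"]) auto
next
  case (step m)
  then obtain R L where RL: "L \<subseteq> R"
    "basis_mod scale (ker_pow f (Suc m)) UNIV fst R" "basis_mod scale (ker_pow g (Suc m)) UNIV snd R"
    "basis_mod scale (ker_pow f (Suc m)) (ker_pow f (Suc (Suc m))) fst L"
    "basis_mod scale (ker_pow g (Suc m)) (ker_pow g (Suc (Suc m))) snd L"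
    "map_prod f g ` (R - L) \<subseteq> R"
    by blast
  have "(mu scale f (Suc m), mu scale g (Suc m)) \<in> ordIso"
    by (rule eq) (use step.hyps in auto)
  then obtain S where S: "basis_mod scale (mu_subspace f (Suc m)) (ker_pow f (Suc m)) fst S"
    "basis_mod scale (mu_subspace g (Suc m)) (ker_pow g (Suc m)) snd S"
    by (rule mu_basis_relation[OF f g, rotated]) auto
  let ?h = "map_prod f g"
  have sf: "basis_mod scale (ker_pow f m) (mu_subspace f (Suc m)) (fst \<circ> ?h) L"
    using basis_mod_ker_pow_shift[OF f RL(4)] by (simp add: comp_def)
  have sg: "basis_mod scale (ker_pow g m) (mu_subspace g (Suc m)) (snd \<circ> ?h) L"
    using basis_mod_ker_pow_shift[OF g RL(5)] by (simp add: comp_def)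
  have inj: "inj_on ?h L"
    using basis_mod_inj_on[OF sf subspace_ker_pow[OF f]] by (rule inj_on_imageI2)
  \<comment> \<open>The new layer: the images of the old layer, completed by new tops of Jordan
    chains.\<close>
  let ?L = "?h ` L \<union> S"
  have Lf: "basis_mod scale (ker_pow f m) (ker_pow f (Suc m)) fst ?L"
    by (rule basis_mod_trans[OF basis_mod_reindex[OF sf inj] S(1)])
  have Lg: "basis_mod scale (ker_pow g m) (ker_pow g (Suc m)) snd ?L"
    by (rule basis_mod_trans[OF basis_mod_reindex[OF sg inj] S(2)])
  show ?case
  proof (rule exI[of _ "?L \<union> R"], rule exI[of _ ?L], intro conjI)
    show "basis_mod scale (ker_pow f m) UNIV fst (?L \<union> R)" by (rule basis_mod_trans[OF Lf RL(2)])
    show "basis_mod scale (ker_pow g m) UNIV snd (?L \<union> R)" by (rule basis_mod_trans[OF Lg RL(3)])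
    \<comment> \<open>A pair of \<open>R\<close> either belongs to the old layer, whose images are
      in \<open>?L\<close>, or has its image in \<open>R\<close> by induction.\<close>
    show "?h ` ((?L \<union> R) - ?L) \<subseteq> ?L \<union> R" using RL(6) by blast
  qed (use Lf Lg in auto)
qed

section \<open>The conjugating automorphism\<close>

text \<open>As \<open>fst\<close> is injective on \<open>R\<close>, the relation is the graph of a
  function on a basis of \<open>V\<close>.\<close>

lemma linear_extend_basis_relation:
  assumes R: "basis_mod scale {0} UNIV fst R"
  obtains \<tau> where "Vector_Spaces.linear scale scale \<tau>" "\<And>x y. (x, y) \<in> R \<Longrightarrow> \<tau> x = y"
proof -
  let ?t = "\<lambda>x. snd (inv_into R fst x)"
  obtain \<tau> where \<tau>: "Vector_Spaces.linear scale scale \<tau>" "\<forall>x\<in>fst ` R. \<tau> x = ?t x"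
    using self.linear_independent_extend[OF basis_mod_0(2)[OF R], of ?t] by blast
  have "\<tau> x = y" if "(x, y) \<in> R" for x y
    using \<tau>(2) that inv_into_f_f[OF basis_mod_0(1)[OF R] that] by force
  with \<tau>(1) that show ?thesis by blast
qed

text \<open>The descent ends at \<open>m = 0\<close> with two matched bases of \<open>V\<close>.
  Extending the matching and its converse linearly gives mutually inverse maps, and commutation is
  checked on the basis.\<close>

lemma conjugate_if_mu_eq:
  assumes f: "Vector_Spaces.linear scale scale f" and g: "Vector_Spaces.linear scale scale g"
    and fn: "ker_pow f n = UNIV" and gn: "ker_pow g n = UNIV"
    and eq: "\<And>i. i \<in> {1..n} \<Longrightarrow> (mu scale f i, mu scale g i) \<in> ordIso"
  obtains \<tau> where "Vector_Spaces.linear scale scale \<tau>" "bij \<tau>" "\<And>x. \<tau> (f x) = g (\<tau> x)"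
proof -
  have ker0: "ker_pow h 0 = {0}" for h :: "'b \<Rightarrow> 'b" by (simp add: ker_pow_def)
  obtain R L where RL: "basis_mod scale {0} UNIV fst R" "basis_mod scale {0} UNIV snd R"
    "basis_mod scale {0} (ker_pow f 1) fst L" "basis_mod scale {0} (ker_pow g 1) snd L"
    "map_prod f g ` (R - L) \<subseteq> R"
    using exists_jordan_basis_relation[OF f g fn gn eq, of 0] by (auto simp: ker0)
  have swap: "basis_mod scale {0} UNIV fst (prod.swap ` R)"
    by (rule basis_mod_reindex) (use RL(2) in \<open>simp_all add: comp_def\<close>)
  obtain \<tau> where \<tau>: "Vector_Spaces.linear scale scale \<tau>" "\<And>x y. (x, y) \<in> R \<Longrightarrow> \<tau> x = y"
    using linear_extend_basis_relation[OF RL(1)] by blast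
  obtain \<sigma> where \<sigma>: "Vector_Spaces.linear scale scale \<sigma>" "\<And>x y. (y, x) \<in> R \<Longrightarrow> \<sigma> x = y"
    using linear_extend_basis_relation[OF swap] by (metis pair_in_swap_image)
  note comp = Vector_Spaces.linear_compose
  have ext: "h = k"
    if "Vector_Spaces.linear scale scale h" "Vector_Spaces.linear scale scale k"
      "\<And>b. b \<in> B \<Longrightarrow> h b = k b" "span B = UNIV" for h k B
    using self.linear_eq_on[OF that(1,2) _ that(3)] that(4) by blast
  have "\<sigma> \<circ> \<tau> = id"
    by (rule ext[OF comp[OF \<tau>(1) \<sigma>(1)] linear_id _ basis_mod_0(3)[OF RL(1)]])
      (use \<tau>(2) \<sigma>(2) in auto)
  moreover have "\<tau> \<circ> \<sigma> = id"
    by (rule ext[OF comp[OF \<sigma>(1) \<tau>(1)] linear_id _ basis_mod_0(3)[OF RL(2)]])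
      (use \<tau>(2) \<sigma>(2) in auto)
  ultimately have "bij \<tau>" using o_bij by blast
  moreover have "\<tau> \<circ> f = g \<circ> \<tau>"
  proof (rule ext[OF comp[OF f \<tau>(1)] comp[OF \<tau>(1) g] _ basis_mod_0(3)[OF RL(1)]])
    fix x assume "x \<in> fst ` R"
    then obtain y where xy: "(x, y) \<in> R" by auto
    \<comment> \<open>On the last layer \<open>f\<close> and \<open>g\<close> vanish; every other
      pair has its image under \<open>map_prod f g\<close> in \<open>R\<close> again.\<close>
    show "(\<tau> \<circ> f) x = (g \<circ> \<tau>) x"
    proof (cases "(x, y) \<in> L")
      case True
      then have "x \<in> ker_pow f 1" "y \<in> ker_pow g 1"
        using basis_mod_subset[OF RL(3)] basis_mod_subset[OF RL(4)] by force+
      then show ?thesis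
        by (simp add: \<tau>(2)[OF xy] ker_pow_def self.linear_0[OF \<tau>(1)])
    next
      case False
      then have "(f x, g y) \<in> R" using RL(5) xy by force
      then show ?thesis using \<tau>(2) xy by simp
    qed
  qed
  ultimately show ?thesis using that[OF \<tau>(1)] by (metis comp_apply)
qed

end

theorem theorem3p10:
  fixes scale :: "'k::field \<Rightarrow> 'v::ab_group_add \<Rightarrow> 'v"
    and f g :: "'v \<Rightarrow> 'v" and n :: nat
  assumes "vector_space scale"
    and "Vector_Spaces.linear scale scale f"
    and "Vector_Spaces.linear scale scale g"
    and "nilpotent_of_order f n"
    and "nilpotent_of_order g n"
  shows "(\<exists>\<tau>. Vector_Spaces.linear scale scale \<tau> \<and> bij \<tau> \<and> g = \<tau> \<circ> f \<circ> inv_into UNIV \<tau>)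
    \<longleftrightarrow> (\<forall>i\<in>{1..n}. (mu scale f i, mu scale g i) \<in> ordIso)"
proof -
  interpret vector_space scale by fact
  have ker: "ker_pow f n = UNIV" "ker_pow g n = UNIV"
    using assms(4,5) by (simp_all add: nilpotent_of_order_def ker_pow_def)
  \<comment> \<open>Both directions work with the inverse-free intertwining relation.\<close>
  have conj_iff: "g = \<tau> \<circ> f \<circ> inv_into UNIV \<tau> \<longleftrightarrow> (\<forall>x. \<tau> (f x) = g (\<tau> x))" if "bij \<tau>" for \<tau>
    using that by (auto simp: fun_eq_iff bij_is_inj bij_is_surj surj_f_inv_f)
  show ?thesis
  proof
    assume "\<exists>\<tau>. Vector_Spaces.linear scale scale \<tau> \<and> bij \<tau> \<and> g = \<tau> \<circ> f \<circ> inv_into UNIV \<tau>"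
    then obtain \<tau> where \<tau>: "Vector_Spaces.linear scale scale \<tau>" "bij \<tau>" "\<And>x. \<tau> (f x) = g (\<tau> x)"
      using conj_iff by blast
    show "\<forall>i\<in>{1..n}. (mu scale f i, mu scale g i) \<in> ordIso"
      using mu_conjugate[OF assms(2,3) \<tau>] by auto
  next
    assume "\<forall>i\<in>{1..n}. (mu scale f i, mu scale g i) \<in> ordIso"
    then obtain \<tau> where "Vector_Spaces.linear scale scale \<tau>" "bij \<tau>" "\<And>x. \<tau> (f x) = g (\<tau> x)"
      using conjugate_if_mu_eq[OF assms(2,3) ker] by blast
    then show "\<exists>\<tau>. Vector_Spaces.linear scale scale \<tau> \<and> bij \<tau> \<and> g = \<tau> \<circ> f \<circ> inv_into UNIV \<tau>"
      using conj_iff by blast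
  qed
qed

end
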